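(* Let $S=\langle n_0,\ldots,n_p\rangle$ be a numerical semigroup on a compound sequence (NSCS), with associated integers $a_1,\ldots,a_p,b_1,\ldots,b_p$. Then $\{a_1n_1,a_2n_2,\ldots,a_pn_p\}$ is the set of Betti elements of $S$.
   Context: Let $\mathbb{N}$ be the positive integers and $\mathbb{N}_0$ the nonnegative integers. A compound sequence is a sequence $\{n_0,\ldots,n_p\}$ with $n_i=b_1b_2\cdots b_i\,a_{i+1}a_{i+2}\cdots a_p$ for $i\in[0,p]$, where $p,a_1,\ldots,a_p,b_1,\ldots,b_p\in\mathbb{N}$ satisfy $2\le a_i<b_i$ for all $i\in[1,p]$ and $\gcd(a_i,b_j)=1$ for all $i,j\in[1,p]$ with $i\ge j$. An NSCS is a numerical semigroup $S=\langle n_0,\ldots,n_p\rangle$ whose minimal generators form a compound sequence. The factorization homomorphism is $\phi:\mathbb{N}_0^{p+1}\to S$, $\phi(x_0,\ldots,x_p)=x_0n_0+\cdots+x_pn_p$; the elements of $\phi^{-1}(n)$ are the factorizations of $n$. An element $n\in S$ with $n>1$ is a Betti element if there is a partition $\phi^{-1}(n)=X\cup Y$ into two nonempty disjoint sets such that $\sum_{i=0}^px_iy_i=0$ for each $x\in X$, $y\in Y$. *)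

theory Defs
  imports Complex_Main "HOL-Library.FuncSet"
begin

definition compound_data :: "nat \<Rightarrow> (nat \<Rightarrow> nat) \<Rightarrow> (nat \<Rightarrow> nat) \<Rightarrow> bool" where
  "compound_data p a b \<longleftrightarrow>
     1 \<le> p \<and>
     (\<forall>i\<in>{1..p}. 2 \<le> a i \<and> a i < b i) \<and>
     (\<forall>i\<in>{1..p}. \<forall>j\<in>{1..p}. j \<le> i \<longrightarrow> gcd (a i) (b j) = 1)"

definition compound_seq :: "nat \<Rightarrow> (nat \<Rightarrow> nat) \<Rightarrow> (nat \<Rightarrow> nat) \<Rightarrow> nat \<Rightarrow> nat" where
  "compound_seq p a b i = (\<Prod>j\<in>{1..i}. b j) * (\<Prod>j\<in>{i+1..p}. a j)"

definition submonoid :: "nat set \<Rightarrow> bool" where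
  "submonoid T \<longleftrightarrow> 0 \<in> T \<and> (\<forall>x\<in>T. \<forall>y\<in>T. x + y \<in> T)"

definition numerical_semigroup :: "nat set \<Rightarrow> bool" where
  "numerical_semigroup S \<longleftrightarrow> submonoid S \<and> finite (- S)"

definition minimal_generating_set :: "nat set \<Rightarrow> nat set \<Rightarrow> bool" where
  "minimal_generating_set S A \<longleftrightarrow>
     submonoid hull A = S \<and> (\<forall>B. B \<subset> A \<longrightarrow> submonoid hull B \<noteq> S)"

definition nscs :: "nat set \<Rightarrow> nat \<Rightarrow> (nat \<Rightarrow> nat) \<Rightarrow> (nat \<Rightarrow> nat) \<Rightarrow> bool" where
  "nscs S p a b \<longleftrightarrow>
     numerical_semigroup S \<and> compound_data p a b \<and>
     minimal_generating_set S (compound_seq p a b ` {0..p})"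

text \<open>Tuples \<open>(x\<^sub>0, \<dots>, x\<^sub>p)\<close> of nonnegative integers are extensional functions on \<open>{0..p}\<close>;
  \<open>g 0, \<dots>, g p\<close> are the generators.\<close>

definition fact_hom :: "nat \<Rightarrow> (nat \<Rightarrow> nat) \<Rightarrow> (nat \<Rightarrow> nat) \<Rightarrow> nat" where
  "fact_hom p g x = (\<Sum>i\<in>{0..p}. x i * g i)"

definition factorizations :: "nat \<Rightarrow> (nat \<Rightarrow> nat) \<Rightarrow> nat \<Rightarrow> (nat \<Rightarrow> nat) set" where
  "factorizations p g n = {x \<in> {0..p} \<rightarrow>\<^sub>E UNIV. fact_hom p g x = n}"

definition betti_element :: "nat set \<Rightarrow> nat \<Rightarrow> (nat \<Rightarrow> nat) \<Rightarrow> nat \<Rightarrow> bool" where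
  "betti_element S p g n \<longleftrightarrow>
     n \<in> S \<and> 1 < n \<and>
     (\<exists>X Y. factorizations p g n = X \<union> Y \<and> X \<inter> Y = {} \<and> X \<noteq> {} \<and> Y \<noteq> {} \<and>
       (\<forall>x\<in>X. \<forall>y\<in>Y. (\<Sum>i\<in>{0..p}. x i * y i) = 0))"

end

theory Submission
  imports Defs "HOL-Number_Theory.Cong"
begin

text \<open>
  Write \<open>A\<^sub>i = a\<^sub>i \<cdots> a\<^sub>p\<close> and \<open>B\<^sub>i = b\<^sub>1 \<cdots> b\<^sub>i\<close>. These are coprime, \<open>A\<^sub>i\<close> divides \<open>n\<^sub>j\<close> for
  \<open>j < i\<close>, \<open>B\<^sub>i\<close> divides \<open>n\<^sub>j\<close> for \<open>j \<ge> i\<close>, and \<open>a\<^sub>i n\<^sub>i = A\<^sub>i B\<^sub>i = b\<^sub>i n\<^sub>i\<^sub>-\<^sub>1\<close>. So a factorization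
  of \<open>a\<^sub>i n\<^sub>i\<close> is supported either on the indices below \<open>i\<close> or on those from \<open>i\<close> on, and both
  cases occur: \<open>a\<^sub>i n\<^sub>i\<close> is a Betti element.

  Conversely, trading \<open>a\<^sub>i\<close> copies of \<open>n\<^sub>i\<close> for \<open>b\<^sub>i\<close> copies of \<open>n\<^sub>i\<^sub>-\<^sub>1\<close> lengthens a factorization.
  If \<open>n\<close> is none of the \<open>a\<^sub>i n\<^sub>i\<close>, such a trade leaves some generator in place and hence stays
  inside each block of the partition. A longest factorization in either block therefore has
  \<open>x\<^sub>i < a\<^sub>i\<close> for all \<open>i \<ge> 1\<close>, but only one factorization of \<open>n\<close> has this property.
\<close>

definition fact_length :: "nat \<Rightarrow> (nat \<Rightarrow> nat) \<Rightarrow> nat" where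
  "fact_length p x = fact_hom p (\<lambda>_. 1) x"

definition orthogonal :: "nat \<Rightarrow> (nat \<Rightarrow> nat) \<Rightarrow> (nat \<Rightarrow> nat) \<Rightarrow> bool" where
  "orthogonal p x y \<longleftrightarrow> (\<Sum>i\<in>{0..p}. x i * y i) = 0"

definition orthogonal_partition ::
    "nat \<Rightarrow> (nat \<Rightarrow> nat) set \<Rightarrow> (nat \<Rightarrow> nat) set \<Rightarrow> (nat \<Rightarrow> nat) set \<Rightarrow> bool" where
  "orthogonal_partition p F X Y \<longleftrightarrow>
     F = X \<union> Y \<and> X \<inter> Y = {} \<and> X \<noteq> {} \<and> Y \<noteq> {} \<and> (\<forall>x\<in>X. \<forall>y\<in>Y. orthogonal p x y)"

definition exchange :: "nat \<Rightarrow> nat \<Rightarrow> nat \<Rightarrow> nat \<Rightarrow> (nat \<Rightarrow> nat) \<Rightarrow> nat \<Rightarrow> nat" where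
  "exchange i c k d x = x(i := x i - c, k := x k + d)"

definition reduced :: "nat \<Rightarrow> (nat \<Rightarrow> nat) \<Rightarrow> (nat \<Rightarrow> nat) \<Rightarrow> bool" where
  "reduced p a x \<longleftrightarrow> (\<forall>i\<in>{1..p}. x i < a i)"

lemma orthogonal_iff: "orthogonal p x y \<longleftrightarrow> (\<forall>i\<le>p. x i = 0 \<or> y i = 0)"
  by (auto simp: orthogonal_def)

lemma orthogonal_sym: "orthogonal p x y \<Longrightarrow> orthogonal p y x"
  by (auto simp: orthogonal_iff)

lemma orthogonal_partition_sym:
  "orthogonal_partition p F X Y \<Longrightarrow> orthogonal_partition p F Y X"
  by (auto simp: orthogonal_partition_def intro: orthogonal_sym)

lemma betti_element_iff_orthogonal_partition:
  "betti_element S p g n \<longleftrightarrow>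
     n \<in> S \<and> 1 < n \<and> (\<exists>X Y. orthogonal_partition p (factorizations p g n) X Y)"
  by (simp add: betti_element_def orthogonal_partition_def orthogonal_def)

lemma fact_hom_split:
  assumes "i \<le> p"
  shows "fact_hom p g x = (\<Sum>j<i. x j * g j) + (\<Sum>j\<in>{i..p}. x j * g j)"
proof -
  have "{0..p} = {..<i} \<union> {i..p}"
    using assms by auto
  then show ?thesis
    unfolding fact_hom_def by (simp add: sum.union_disjoint ivl_disj_int)
qed

lemma fact_hom_eq_single:
  assumes "k \<le> p" "\<And>j. j \<le> p \<Longrightarrow> x j = (if j = k then c else 0)"
  shows "fact_hom p g x = c * g k"
proof -
  have "fact_hom p g x = (\<Sum>j\<in>{0..p}. if j = k then c * g j else 0)"
    unfolding fact_hom_def using assms(2) by (intro sum.cong) auto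
  also have "\<dots> = c * g k"
    using assms(1) by simp
  finally show ?thesis .
qed

lemma single_generator_factorization:
  assumes "k \<le> p"
  shows "(\<lambda>j\<in>{0..p}. if j = k then c else 0) \<in> factorizations p g (c * g k)"
  using fact_hom_eq_single[OF assms] by (simp add: factorizations_def)

lemma fact_length_le:
  assumes "x \<in> factorizations p g n" "\<And>i. i \<le> p \<Longrightarrow> 0 < g i"
  shows "fact_length p x \<le> n"
proof -
  have "fact_length p x \<le> fact_hom p g x"
    unfolding fact_length_def fact_hom_def using assms(2)
    by (intro sum_mono mult_le_mono2) (simp add: Suc_le_eq)
  then show ?thesis
    using assms(1) by (simp add: factorizations_def)
qed

lemma fact_hom_exchange:
  assumes "i \<le> p" "k \<le> p" "i \<noteq> k" "c \<le> x i"
  shows "fact_hom p g (exchange i c k d x) + c * g i = fact_hom p g x + d * g k"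
proof -
  have "exchange i c k d x j * g j + (if j = i then c * g j else 0)
      = x j * g j + (if j = k then d * g j else 0)" for j
    using assms(3,4) by (auto simp: exchange_def simp flip: add_mult_distrib)
  then have "(\<Sum>j\<in>{0..p}. exchange i c k d x j * g j + (if j = i then c * g j else 0))
      = (\<Sum>j\<in>{0..p}. x j * g j + (if j = k then d * g j else 0))"
    by simp
  then show ?thesis
    using assms(1,2) by (simp add: fact_hom_def sum.distrib)
qed

lemma exchange_in_factorizations:
  assumes "x \<in> factorizations p g n" "i \<le> p" "k \<le> p" "i \<noteq> k" "c \<le> x i" "c * g i = d * g k"
  shows "exchange i c k d x \<in> factorizations p g n"
proof -
  have "exchange i c k d x \<in> {0..p} \<rightarrow>\<^sub>E UNIV"
    using assms(1-3) by (auto simp: exchange_def factorizations_def PiE_iff extensional_def)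
  then show ?thesis
    using assms fact_hom_exchange[of i p k c x g d] by (simp add: factorizations_def)
qed

lemma orthogonal_exchange_imp_fact_hom_eq:
  assumes "orthogonal p x (exchange i c k d x)" "i \<le> p" "i \<noteq> k" "c \<le> x i"
  shows "fact_hom p g x = c * g i"
proof (rule fact_hom_eq_single[OF assms(2)])
  fix j assume "j \<le> p"
  then have "x j = 0 \<or> exchange i c k d x j = 0"
    using assms(1) by (simp add: orthogonal_iff)
  then show "x j = (if j = i then c else 0)"
    using assms(3,4) by (auto simp: exchange_def split: if_splits)
qed

lemma longer_nonorthogonal_factorization:
  assumes x: "x \<in> factorizations p g n"
    and idx: "i \<le> p" "k \<le> p" "i \<noteq> k" "c \<le> x i"
    and "c * g i = d * g k" "c < d" "n \<noteq> c * g i"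
  obtains y where "y \<in> factorizations p g n" "\<not> orthogonal p x y"
    "fact_length p x < fact_length p y"
proof
  show "exchange i c k d x \<in> factorizations p g n"
    using x idx \<open>c * g i = d * g k\<close> by (rule exchange_in_factorizations)
  show "\<not> orthogonal p x (exchange i c k d x)"
  proof
    assume "orthogonal p x (exchange i c k d x)"
    then have "fact_hom p g x = c * g i"
      using idx(1,3,4) by (rule orthogonal_exchange_imp_fact_hom_eq)
    then show False
      using x \<open>n \<noteq> c * g i\<close> by (simp add: factorizations_def)
  qed
  show "fact_length p x < fact_length p (exchange i c k d x)"
    using fact_hom_exchange[of i p k c x "\<lambda>_. 1" d] idx \<open>c < d\<close> by (simp add: fact_length_def)
qed

lemma reduced_in_orthogonal_partition:
  assumes pos: "\<And>i. i \<le> p \<Longrightarrow> 0 < g i"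
    and exch: "\<And>i. i \<in> {1..p} \<Longrightarrow> a i * g i = b i * g (i - 1)"
    and less: "\<And>i. i \<in> {1..p} \<Longrightarrow> a i < b i"
    and n: "n \<notin> (\<lambda>i. a i * g i) ` {1..p}"
    and part: "orthogonal_partition p (factorizations p g n) X Y"
  shows "\<exists>x\<in>X. reduced p a x"
proof -
  have F: "factorizations p g n = X \<union> Y" and orth: "\<forall>x\<in>X. \<forall>y\<in>Y. orthogonal p x y"
    using part by (auto simp: orthogonal_partition_def)
  have "fact_length p x \<le> n" if "x \<in> X" for x
    using that F by (intro fact_length_le[OF _ pos]) auto
  then have bound: "\<forall>x. x \<in> X \<longrightarrow> fact_length p x < Suc n"
    by (simp add: less_Suc_eq_le)
  obtain x\<^sub>0 where "x\<^sub>0 \<in> X"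
    using part by (auto simp: orthogonal_partition_def)
  from ex_has_greatest_nat[of "\<lambda>x. x \<in> X", OF this bound]
  obtain x where x: "x \<in> X" and longest: "\<forall>y. y \<in> X \<longrightarrow> fact_length p y \<le> fact_length p x"
    by blast
  have "x i < a i" if i: "i \<in> {1..p}" for i
  proof (rule ccontr)
    assume "\<not> x i < a i"
    then have idx: "i \<le> p" "i - 1 \<le> p" "i \<noteq> i - 1" "a i \<le> x i"
      using i by auto
    have "x \<in> factorizations p g n"
      using x F by blast
    moreover note idx exch[OF i] less[OF i]
    moreover have "n \<noteq> a i * g i"
      using n i by blast
    ultimately obtain y where "y \<in> factorizations p g n" "\<not> orthogonal p x y"
        and longer: "fact_length p x < fact_length p y"
      by (rule longer_nonorthogonal_factorization)
    then have "y \<in> X"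
      using F orth x by blast
    with longer longest show False
      by (simp add: leD)
  qed
  then have "reduced p a x"
    by (simp add: reduced_def)
  with x show ?thesis
    by blast
qed

lemma betti_element_imp_exchange_value:
  assumes "\<And>i. i \<le> p \<Longrightarrow> 0 < g i"
    and "\<And>i. i \<in> {1..p} \<Longrightarrow> a i * g i = b i * g (i - 1)"
    and "\<And>i. i \<in> {1..p} \<Longrightarrow> a i < b i"
    and unique: "\<And>x y. \<lbrakk>x \<in> factorizations p g n; y \<in> factorizations p g n;
      reduced p a x; reduced p a y\<rbrakk> \<Longrightarrow> x = y"
    and "betti_element S p g n"
  shows "n \<in> (\<lambda>i. a i * g i) ` {1..p}"
proof (rule ccontr)
  assume n: "n \<notin> (\<lambda>i. a i * g i) ` {1..p}"
  have reduced_in_block: "\<exists>x\<in>X. reduced p a x"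
    if "orthogonal_partition p (factorizations p g n) X Y" for X Y
    using assms(1-3) n that by (rule reduced_in_orthogonal_partition)
  obtain X Y where part: "orthogonal_partition p (factorizations p g n) X Y"
    using assms(5) by (auto simp: betti_element_iff_orthogonal_partition)
  obtain x where "x \<in> X" "reduced p a x"
    using reduced_in_block[OF part] by blast
  moreover obtain y where "y \<in> Y" "reduced p a y"
    using reduced_in_block[OF orthogonal_partition_sym[OF part]] by blast
  ultimately show False
    using unique[of x y] part by (auto simp: orthogonal_partition_def)
qed

lemma fact_hom_reduced_inject:
  assumes "0 < g 0"
    and "\<And>j k. \<lbrakk>j < k; k \<le> p\<rbrakk> \<Longrightarrow> D k dvd g j"
    and "\<And>k u v. \<lbrakk>k \<in> {1..p}; [u * g k = v * g k] (mod D k)\<rbrakk> \<Longrightarrow> [u = v] (mod a k)"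
    and "reduced p a x" "reduced p a y" "fact_hom p g x = fact_hom p g y"
    and "i \<le> p"
  shows "x i = y i"
  using assms(2-)
proof (induction p arbitrary: i)
  case 0
  then show ?case
    using assms(1) by (simp add: fact_hom_def)
next
  case (Suc p)
  have fact_hom_Suc: "fact_hom (Suc p) g z = fact_hom p g z + z (Suc p) * g (Suc p)" for z
    by (simp add: fact_hom_def)
  have dvd: "D (Suc p) dvd fact_hom p g z" for z
    unfolding fact_hom_def using Suc.prems(1) by (intro dvd_sum dvd_mult) simp
  have top_cong: "[fact_hom (Suc p) g z = z (Suc p) * g (Suc p)] (mod D (Suc p))" for z
    using dvd[of z] by (auto simp: fact_hom_Suc cong_def elim!: dvdE)
  have "[x (Suc p) * g (Suc p) = y (Suc p) * g (Suc p)] (mod D (Suc p))"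
    using top_cong[of x] top_cong[of y] Suc.prems(5) by (simp add: cong_def)
  then have "[x (Suc p) = y (Suc p)] (mod a (Suc p))"
    using Suc.prems(2) by simp
  then have top: "x (Suc p) = y (Suc p)"
    using Suc.prems(3,4) by (simp add: reduced_def cong_less_modulus_unique_nat)
  show ?case
  proof (cases "i = Suc p")
    case True
    then show ?thesis
      using top by simp
  next
    case False
    have "fact_hom p g x = fact_hom p g y"
      using Suc.prems(5) top by (simp add: fact_hom_Suc)
    with False show ?thesis
      using Suc.prems by (intro Suc.IH) (auto simp: reduced_def)
  qed
qed

lemma coprime_summands_of_product:
  fixes A B s t :: nat
  assumes "coprime A B" "A dvd s" "B dvd t" "s + t = A * B"
  shows "s = 0 \<or> t = 0"
proof -
  have "B dvd s"
    using assms(3,4) by (metis dvd_add_left_iff dvd_triv_right)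
  then have "A * B dvd s"
    using assms(1,2) by (simp add: divides_mult)
  then show ?thesis
    using assms(4) by (metis add_cancel_right_right dvd_imp_le le_add1 le_antisym neq0_conv)
qed

lemma coprime_product_factorization_support:
  assumes pos: "\<And>j. j \<le> p \<Longrightarrow> 0 < g j"
    and "coprime A B" "i \<le> p"
    and below: "\<And>j. j < i \<Longrightarrow> A dvd g j"
    and above: "\<And>j. j \<in> {i..p} \<Longrightarrow> B dvd g j"
    and x: "x \<in> factorizations p g n" and n: "n = A * B"
  shows "(\<forall>j<i. x j = 0) \<or> (\<forall>j\<in>{i..p}. x j = 0)"
proof -
  have "(\<Sum>j<i. x j * g j) = 0 \<or> (\<Sum>j\<in>{i..p}. x j * g j) = 0"
  proof (rule coprime_summands_of_product[OF \<open>coprime A B\<close>])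
    show "A dvd (\<Sum>j<i. x j * g j)"
      using below by (intro dvd_sum dvd_mult) simp
    show "B dvd (\<Sum>j\<in>{i..p}. x j * g j)"
      using above by (intro dvd_sum dvd_mult)
    show "(\<Sum>j<i. x j * g j) + (\<Sum>j\<in>{i..p}. x j * g j) = A * B"
      using x n by (simp add: factorizations_def flip: fact_hom_split[OF \<open>i \<le> p\<close>])
  qed
  moreover have "g j \<noteq> 0" if "j \<le> p" for j
    using pos[OF that] by simp
  ultimately show ?thesis
    using \<open>i \<le> p\<close> by auto
qed

lemma betti_element_coprime_product:
  assumes pos: "\<And>j. j \<le> p \<Longrightarrow> 0 < g j"
    and "coprime A B" "i \<le> p"
    and below: "\<And>j. j < i \<Longrightarrow> A dvd g j"
    and above: "\<And>j. j \<in> {i..p} \<Longrightarrow> B dvd g j"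
    and n: "n = A * B" "n \<in> S" "1 < n"
    and u: "u \<in> factorizations p g n" "\<And>j. j < i \<Longrightarrow> u j = 0"
    and v: "v \<in> factorizations p g n" "\<And>j. j \<in> {i..p} \<Longrightarrow> v j = 0"
  shows "betti_element S p g n"
proof -
  let ?F = "factorizations p g n"
  define X where "X = {x \<in> ?F. \<forall>j<i. x j = 0}"
  define Y where "Y = {x \<in> ?F. \<forall>j\<in>{i..p}. x j = 0}"
  have "(\<forall>j<i. x j = 0) \<or> (\<forall>j\<in>{i..p}. x j = 0)" if "x \<in> ?F" for x
    using pos \<open>coprime A B\<close> \<open>i \<le> p\<close> below above that n(1)
    by (rule coprime_product_factorization_support)
  then have "?F = X \<union> Y"
    unfolding X_def Y_def by blast
  moreover have "X \<inter> Y = {}"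
  proof -
    have "fact_hom p g x = 0" if "x \<in> X" "x \<in> Y" for x
      using that by (simp add: X_def Y_def fact_hom_split[OF \<open>i \<le> p\<close>])
    then show ?thesis
      using n(3) by (force simp: X_def factorizations_def)
  qed
  moreover have "u \<in> X" "v \<in> Y"
    using u v by (simp_all add: X_def Y_def)
  moreover have "orthogonal p x y" if "x \<in> X" "y \<in> Y" for x y
  proof -
    have "x j = 0 \<or> y j = 0" if "j \<le> p" for j
      using \<open>x \<in> X\<close> \<open>y \<in> Y\<close> that by (cases "j < i") (simp_all add: X_def Y_def)
    then show ?thesis
      by (simp add: orthogonal_iff)
  qed
  ultimately have "orthogonal_partition p ?F X Y"
    unfolding orthogonal_partition_def by blast
  then show ?thesis
    using n(2,3) by (auto simp: betti_element_iff_orthogonal_partition)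
qed

lemma prod_dvd_compound_seq_below:
  assumes "j < i"
  shows "(\<Prod>k\<in>{i..p}. a k) dvd compound_seq p a b j"
  using assms unfolding compound_seq_def by (intro dvd_mult prod_dvd_prod_subset) auto

lemma prod_dvd_compound_seq_above:
  assumes "i \<le> j"
  shows "(\<Prod>k\<in>{1..i}. b k) dvd compound_seq p a b j"
  using assms unfolding compound_seq_def by (intro dvd_mult2 prod_dvd_prod_subset) auto

lemma mult_compound_seq_eq:
  assumes "i \<le> p"
  shows "a i * compound_seq p a b i = (\<Prod>k\<in>{i..p}. a k) * (\<Prod>k\<in>{1..i}. b k)"
  using prod.atLeast_Suc_atMost[OF assms, of a]
  by (simp add: compound_seq_def mult_ac)

lemma compound_seq_exchange:
  assumes "i \<in> {1..p}"
  shows "a i * compound_seq p a b i = b i * compound_seq p a b (i - 1)"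
proof -
  have "(\<Prod>k\<in>{1..i}. b k) = (\<Prod>k\<in>{1..i - 1}. b k) * b i"
    using assms by (cases i) simp_all
  then show ?thesis
    using assms by (simp add: mult_compound_seq_eq) (simp add: compound_seq_def mult_ac)
qed

lemma compound_data_bounds:
  assumes "compound_data p a b" "i \<in> {1..p}"
  shows "2 \<le> a i" "a i < b i"
  using assms by (auto simp: compound_data_def)

lemma compound_data_coprime:
  assumes "compound_data p a b" "1 \<le> j" "j \<le> i" "i \<le> p"
  shows "coprime (a i) (b j)"
  using assms by (auto simp: compound_data_def coprime_iff_gcd_eq_1)

lemma compound_data_coprime_prods:
  assumes "compound_data p a b" "1 \<le> i"
  shows "coprime (\<Prod>k\<in>{i..p}. a k) (\<Prod>k\<in>{1..i}. b k)"
  using assms by (intro prod_coprime_left prod_coprime_right)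
    (auto intro: compound_data_coprime)

lemma compound_seq_pos:
  assumes "compound_data p a b" "i \<le> p"
  shows "0 < compound_seq p a b i"
proof -
  have "0 < a j" "0 < b j" if "j \<in> {1..p}" for j
    using compound_data_bounds[OF assms(1) that] by linarith+
  then show ?thesis
    using assms(2) by (auto simp: compound_seq_def intro!: prod_pos)
qed

lemma compound_seq_cong_cancel:
  assumes cd: "compound_data p a b" and k: "k \<in> {1..p}"
    and uv: "[u * compound_seq p a b k = v * compound_seq p a b k] (mod (\<Prod>j\<in>{k..p}. a j))"
  shows "[u = v] (mod a k)"
proof -
  define A where "A = (\<Prod>j\<in>{k+1..p}. a j)"
  define B where "B = (\<Prod>j\<in>{1..k}. b j)"
  have seq: "compound_seq p a b k = B * A"
    by (simp add: compound_seq_def A_def B_def)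
  have "(\<Prod>j\<in>{k..p}. a j) = a k * A"
    using k prod.atLeast_Suc_atMost[of k p a] by (simp add: A_def)
  then have "[(u * B) * A = (v * B) * A] (mod a k * A)"
    using uv by (simp add: seq mult.assoc)
  moreover have "A \<noteq> 0"
    using compound_seq_pos[OF cd, of k] k by (simp add: seq)
  ultimately have "[u * B = v * B] (mod a k)"
    by (simp add: cong_def)
  moreover have "coprime B (a k)"
    unfolding B_def using k by (intro prod_coprime_left)
      (auto intro: compound_data_coprime[OF cd] simp: coprime_commute)
  ultimately show ?thesis
    by (simp add: cong_mult_rcancel_nat)
qed

lemma reduced_factorization_unique:
  assumes cd: "compound_data p a b"
    and x: "x \<in> factorizations p (compound_seq p a b) n" "reduced p a x"
    and y: "y \<in> factorizations p (compound_seq p a b) n" "reduced p a y"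
  shows "x = y"
proof (rule PiE_ext)
  show "x \<in> {0..p} \<rightarrow>\<^sub>E UNIV" "y \<in> {0..p} \<rightarrow>\<^sub>E UNIV"
    using x(1) y(1) by (simp_all add: factorizations_def)
  fix i
  assume "i \<in> {0..p}"
  show "x i = y i"
  proof (rule fact_hom_reduced_inject[OF _ _ _ x(2) y(2)])
    show "0 < compound_seq p a b 0"
      using cd by (rule compound_seq_pos) simp
    show "(\<Prod>l\<in>{k..p}. a l) dvd compound_seq p a b j" if "j < k" for j k
      using that by (rule prod_dvd_compound_seq_below)
    show "[u = v] (mod a k)"
      if "k \<in> {1..p}"
        "[u * compound_seq p a b k = v * compound_seq p a b k] (mod (\<Prod>l\<in>{k..p}. a l))" for k u v
      using cd that by (rule compound_seq_cong_cancel)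
    show "fact_hom p (compound_seq p a b) x = fact_hom p (compound_seq p a b) y"
      using x(1) y(1) by (simp add: factorizations_def)
    show "i \<le> p"
      using \<open>i \<in> {0..p}\<close> by simp
  qed
qed

lemma betti_element_compound_seq:
  assumes cd: "compound_data p a b" and i: "i \<in> {1..p}"
    and S: "a i * compound_seq p a b i \<in> S"
  shows "betti_element S p (compound_seq p a b) (a i * compound_seq p a b i)"
proof (rule betti_element_coprime_product[OF compound_seq_pos[OF cd]])
  let ?g = "compound_seq p a b"
  have idx: "i \<le> p" "i - 1 \<le> p"
    using i by auto
  show "i \<le> p"
    by (rule idx)
  show "coprime (\<Prod>k\<in>{i..p}. a k) (\<Prod>k\<in>{1..i}. b k)"
    using i by (intro compound_data_coprime_prods[OF cd]) simp
  show "(\<Prod>k\<in>{i..p}. a k) dvd ?g j" if "j < i" for j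
    using that by (rule prod_dvd_compound_seq_below)
  show "(\<Prod>k\<in>{1..i}. b k) dvd ?g j" if "j \<in> {i..p}" for j
    using that by (intro prod_dvd_compound_seq_above) simp
  show "a i * ?g i = (\<Prod>k\<in>{i..p}. a k) * (\<Prod>k\<in>{1..i}. b k)"
    using idx(1) by (rule mult_compound_seq_eq)
  have "2 * 1 \<le> a i * ?g i"
    using compound_data_bounds(1)[OF cd i] compound_seq_pos[OF cd idx(1)]
    by (intro mult_le_mono) auto
  then show "1 < a i * ?g i"
    by simp
  show "(\<lambda>j\<in>{0..p}. if j = i then a i else 0) \<in> factorizations p ?g (a i * ?g i)"
    using idx(1) by (rule single_generator_factorization)
  show "(\<lambda>j\<in>{0..p}. if j = i - 1 then b i else 0) \<in> factorizations p ?g (a i * ?g i)"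
    unfolding compound_seq_exchange[OF i] using idx(2) by (rule single_generator_factorization)
qed (use i S in auto)

lemma submonoid_mult_closed:
  assumes "submonoid T" "x \<in> T"
  shows "m * x \<in> T"
  using assms by (induction m) (auto simp: submonoid_def)

theorem corollary10:
  fixes S :: "nat set" and p :: nat and a b :: "nat \<Rightarrow> nat"
  assumes "nscs S p a b"
  shows "{n. betti_element S p (compound_seq p a b) n} =
         (\<lambda>i. a i * compound_seq p a b i) ` {1..p}"
proof -
  let ?g = "compound_seq p a b"
  have cd: "compound_data p a b" and S: "submonoid S" and hull: "submonoid hull (?g ` {0..p}) = S"
    using assms by (auto simp: nscs_def numerical_semigroup_def minimal_generating_set_def)
  have "n \<in> (\<lambda>i. a i * ?g i) ` {1..p}" if "betti_element S p ?g n" for n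
    using compound_seq_pos[OF cd] compound_seq_exchange compound_data_bounds(2)[OF cd]
      reduced_factorization_unique[OF cd] that
    by (rule betti_element_imp_exchange_value)
  moreover have "betti_element S p ?g (a i * ?g i)" if "i \<in> {1..p}" for i
  proof (rule betti_element_compound_seq[OF cd that])
    have "?g i \<in> S"
      using that hull_subset[of "?g ` {0..p}" submonoid] hull by auto
    then show "a i * ?g i \<in> S"
      using S by (intro submonoid_mult_closed)
  qed
  ultimately show ?thesis
    by auto
qed

end
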